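(* The proof system $\mathbb{IRIK}$ is sound and strongly complete with respect to the class of all proper bi-frames. That is, for every set $\Gamma$ of formulas and every formula $\varphi$ of the language $\mathbf{IRI}$: $\Gamma\vdash_{\mathbb{IRIK}}\varphi$ if and only if $\Gamma\vDash_F\varphi$, where $F$ is the class of all proper bi-frames.
   Context: Language. Fix a nonempty set $\mathbf{P}$ of propositional variables. The formulas of the language $\mathbf{IRI}$ are given by $\varphi::=p\mid\neg\varphi\mid(\varphi\land\varphi)\mid I\varphi\mid I^R\varphi$ with $p\in\mathbf{P}$ ($I\varphi$: one is first-order ignorant whether $\varphi$; $I^R\varphi$: one is Rumsfeld ignorant of $\varphi$). Other Boolean connectives $\vee,\to,\leftrightarrow,\top,\bot$ are defined as usual. Bi-semantics. A bi-frame is a triple $\langle S,R,R^\bullet\rangle$ with $S$ a nonempty set and $R,R^\bullet$ binary relations on $S$; a bi-model $\mathcal{M}=\langle S,R,R^\bullet,V\rangle$ is a bi-frame with a valuation $V:\mathbf{P}\to\mathcal{P}(S)$. A bi-frame (bi-model) is proper if $R\subseteq R^\bullet$. Truth at $s\in S$: $\mathcal{M},s\vDash p$ iff $s\in V(p)$; $\neg,\land$ are interpreted classically; $\mathcal{M},s\vDash I\varphi$ iff there is $t$ with $sRt$ and $\mathcal{M},t\vDash\varphi$, and there is $u$ with $sRu$ and $\mathcal{M},u\nvDash\varphi$; $\mathcal{M},s\vDash I^R\varphi$ iff $\mathcal{M},s\vDash I\varphi$ and there is $t$ with $sR^\bullet t$ and $\mathcal{M},t\nvDash I\varphi$. For a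 class $F$ of bi-frames, $\Gamma\vDash_F\varphi$ means: for every bi-model $\mathcal{M}$ based on a bi-frame in $F$ and every state $s$ of $\mathcal{M}$, if $\mathcal{M},s\vDash\gamma$ for all $\gamma\in\Gamma$, then $\mathcal{M},s\vDash\varphi$. Proof system $\mathbb{IRIK}$. Axioms: all instances of propositional tautologies; $I\varphi\leftrightarrow I\neg\varphi$; $I^R\varphi\leftrightarrow I^R\neg\varphi$; $I(\varphi\land\psi)\to(I\varphi\vee I\psi)$; $I(\varphi\vee\psi)\land I(\neg\varphi\vee\chi)\to I\varphi$; $I^R\varphi\to I\varphi$; $I\varphi\land I(I\varphi\vee\chi)\to I^R\varphi$. Rules: modus ponens; from $\varphi$ infer $\neg I\varphi$; from $\varphi\leftrightarrow\psi$ infer $I\varphi\leftrightarrow I\psi$; from $\varphi\leftrightarrow\psi$ infer $I^R\varphi\leftrightarrow I^R\psi$; for every $n\in\mathbb{N}$, from $I\chi_1\land\cdots\land I\chi_n\to I\varphi$ infer $(\neg I^R\chi_1\land I\chi_1)\land\cdots\land(\neg I^R\chi_n\land I\chi_n)\to\neg I^R\varphi$. Theoremhood ($\vdash\varphi$) is as usual, and $\Gamma\vdash\varphi$ means that $\vdash\gamma_1\land\cdots\land\gamma_k\to\varphi$ for some finitely many $\gamma_1,\dots,\gamma_k\in\Gamma$. *)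

theory Defs
  imports Main
begin

text \<open>The set of propositional variables is the type \<open>'p\<close>; types are nonempty.\<close>

datatype 'p fm =
    Var 'p
  | Neg "'p fm"
  | Con "'p fm" "'p fm"
  | Ign "'p fm"
  | RIgn "'p fm"  \<comment> \<open>Rumsfeld ignorance\<close>

definition Dis :: "'p fm \<Rightarrow> 'p fm \<Rightarrow> 'p fm" where
  "Dis \<phi> \<psi> = Neg (Con (Neg \<phi>) (Neg \<psi>))"

definition Imp :: "'p fm \<Rightarrow> 'p fm \<Rightarrow> 'p fm" where
  "Imp \<phi> \<psi> = Neg (Con \<phi> (Neg \<psi>))"

definition Iff :: "'p fm \<Rightarrow> 'p fm \<Rightarrow> 'p fm" where
  "Iff \<phi> \<psi> = Con (Imp \<phi> \<psi>) (Imp \<psi> \<phi>)"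

text \<open>There is no primitive constant, so \<open>\<top>\<close> is \<open>p \<or> \<not>p\<close> for an arbitrary but fixed variable \<open>p\<close>.\<close>

definition Top :: "'p fm" where
  "Top = Dis (Var undefined) (Neg (Var undefined))"

fun conj_list :: "'p fm list \<Rightarrow> 'p fm" where
  "conj_list [] = Top"
| "conj_list [\<phi>] = \<phi>"
| "conj_list (\<phi> # \<psi> # \<phi>s) = Con \<phi> (conj_list (\<psi> # \<phi>s))"


record 'w biframe =
  states :: "'w set"
  rel :: "'w rel"
  brel :: "'w rel"  \<comment> \<open>the relation \<open>R\<^sup>\<bullet>\<close>\<close>

record ('w, 'p) bimodel = "'w biframe" +
  val :: "'p \<Rightarrow> 'w set"

definition is_biframe :: "'w biframe \<Rightarrow> bool" where
  "is_biframe F \<longleftrightarrow> states F \<noteq> {} \<and> rel F \<subseteq> states F \<times> states F \<and> brel F \<subseteq> states F \<times> states F"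

definition proper_biframes :: "'w biframe set" where
  "proper_biframes = {F. is_biframe F \<and> rel F \<subseteq> brel F}"

text \<open>The bi-frame on which a bi-model \<open>M\<close> is based is \<open>biframe.truncate M\<close>.\<close>

definition is_bimodel :: "('w, 'p) bimodel \<Rightarrow> bool" where
  "is_bimodel M \<longleftrightarrow> is_biframe (biframe.truncate M) \<and> (\<forall>p. val M p \<subseteq> states M)"

fun sat :: "('w, 'p) bimodel \<Rightarrow> 'w \<Rightarrow> 'p fm \<Rightarrow> bool" where
  "sat M s (Var p) \<longleftrightarrow> s \<in> val M p"
| "sat M s (Neg \<phi>) \<longleftrightarrow> \<not> sat M s \<phi>"
| "sat M s (Con \<phi> \<psi>) \<longleftrightarrow> sat M s \<phi> \<and> sat M s \<psi>"
| "sat M s (Ign \<phi>) \<longleftrightarrow>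
     (\<exists>t. (s, t) \<in> rel M \<and> sat M t \<phi>) \<and> (\<exists>u. (s, u) \<in> rel M \<and> \<not> sat M u \<phi>)"
| "sat M s (RIgn \<phi>) \<longleftrightarrow>
     ((\<exists>t. (s, t) \<in> rel M \<and> sat M t \<phi>) \<and> (\<exists>u. (s, u) \<in> rel M \<and> \<not> sat M u \<phi>)) \<and>
     (\<exists>t. (s, t) \<in> brel M \<and>
        \<not> ((\<exists>v. (t, v) \<in> rel M \<and> sat M v \<phi>) \<and> (\<exists>u. (t, u) \<in> rel M \<and> \<not> sat M u \<phi>)))"

text \<open>The clause for \<open>RIgn\<close> has \<open>sat M _ (Ign \<phi>)\<close> written out, to keep the recursion structural.\<close>

lemma sat_RIgn:
  "sat M s (RIgn \<phi>) \<longleftrightarrow> sat M s (Ign \<phi>) \<and> (\<exists>t. (s, t) \<in> brel M \<and> \<not> sat M t (Ign \<phi>))"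
  by simp

definition conseq :: "'w biframe set \<Rightarrow> 'p fm set \<Rightarrow> 'p fm \<Rightarrow> bool" where
  "conseq F \<Gamma> \<phi> \<longleftrightarrow>
     (\<forall>M :: ('w, 'p) bimodel. is_bimodel M \<longrightarrow> biframe.truncate M \<in> F \<longrightarrow>
        (\<forall>s\<in>states M. (\<forall>\<gamma>\<in>\<Gamma>. sat M s \<gamma>) \<longrightarrow> sat M s \<phi>))"


text \<open>Instances of propositional tautologies are the formulas that come out true under every
  Boolean evaluation \<open>v\<close> in which variables and formulas \<open>I\<phi>\<close>, \<open>I\<^sup>R\<phi>\<close> are treated as atoms.\<close>

fun prop_eval :: "('p fm \<Rightarrow> bool) \<Rightarrow> 'p fm \<Rightarrow> bool" where
  "prop_eval v (Neg \<phi>) \<longleftrightarrow> \<not> prop_eval v \<phi>"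
| "prop_eval v (Con \<phi> \<psi>) \<longleftrightarrow> prop_eval v \<phi> \<and> prop_eval v \<psi>"
| "prop_eval v (Var p) \<longleftrightarrow> v (Var p)"
| "prop_eval v (Ign \<phi>) \<longleftrightarrow> v (Ign \<phi>)"
| "prop_eval v (RIgn \<phi>) \<longleftrightarrow> v (RIgn \<phi>)"

definition tautology :: "'p fm \<Rightarrow> bool" where
  "tautology \<phi> \<longleftrightarrow> (\<forall>v. prop_eval v \<phi>)"

inductive thm_IRIK :: "'p fm \<Rightarrow> bool" where
  taut: "tautology \<phi> \<Longrightarrow> thm_IRIK \<phi>"
| I_neg: "thm_IRIK (Iff (Ign \<phi>) (Ign (Neg \<phi>)))"
| IR_neg: "thm_IRIK (Iff (RIgn \<phi>) (RIgn (Neg \<phi>)))"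
| I_con: "thm_IRIK (Imp (Ign (Con \<phi> \<psi>)) (Dis (Ign \<phi>) (Ign \<psi>)))"
| I_dis: "thm_IRIK (Imp (Con (Ign (Dis \<phi> \<psi>)) (Ign (Dis (Neg \<phi>) \<chi>))) (Ign \<phi>))"
| IR_I: "thm_IRIK (Imp (RIgn \<phi>) (Ign \<phi>))"
| I_IR: "thm_IRIK (Imp (Con (Ign \<phi>) (Ign (Dis (Ign \<phi>) \<chi>))) (RIgn \<phi>))"
| MP: "thm_IRIK \<phi> \<Longrightarrow> thm_IRIK (Imp \<phi> \<psi>) \<Longrightarrow> thm_IRIK \<psi>"
| not_I: "thm_IRIK \<phi> \<Longrightarrow> thm_IRIK (Neg (Ign \<phi>))"
| RE_I: "thm_IRIK (Iff \<phi> \<psi>) \<Longrightarrow> thm_IRIK (Iff (Ign \<phi>) (Ign \<psi>))"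
| RE_IR: "thm_IRIK (Iff \<phi> \<psi>) \<Longrightarrow> thm_IRIK (Iff (RIgn \<phi>) (RIgn \<psi>))"
| R_IR: "thm_IRIK (Imp (conj_list (map Ign \<chi>s)) (Ign \<phi>)) \<Longrightarrow>
    thm_IRIK (Imp (conj_list (map (\<lambda>\<chi>. Con (Neg (RIgn \<chi>)) (Ign \<chi>)) \<chi>s)) (Neg (RIgn \<phi>)))"

definition deriv_IRIK :: "'p fm set \<Rightarrow> 'p fm \<Rightarrow> bool" where
  "deriv_IRIK \<Gamma> \<phi> \<longleftrightarrow> (\<exists>\<gamma>s. set \<gamma>s \<subseteq> \<Gamma> \<and> thm_IRIK (Imp (conj_list \<gamma>s) \<phi>))"


text \<open>A formula cannot quantify over types, so consequence over the class of all proper bi-frames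
  splits into two parts: soundness for states of an arbitrary type, and completeness already with
  respect to the bi-frames whose states are taken from \<open>'p fm set\<close>, which is large
  enough for every set of formulas over \<open>'p\<close>. As the bi-frames have an arbitrary carrier
  \<open>states F\<close>, all cardinalities up to that of the type occur.\<close>

end

theory Submission
  imports Defs
begin

text \<open>Completeness uses a canonical model on the maximal consistent sets. Let \<open>\<lambda>(s)\<close> consist of the
  \<open>\<phi>\<close> such that \<open>I(\<phi> \<or> \<chi>) \<notin> s\<close> for all \<open>\<chi>\<close>; in a model this says that \<open>\<phi>\<close> holds at all
  successors, provided that something is ignored at \<open>s\<close>. Put \<open>s R t\<close> iff \<open>\<lambda>(s) \<subseteq> t\<close>, and \<open>s R\<^sup>\<bullet> t\<close>
  iff \<open>I\<chi> \<in> t\<close> whenever \<open>I\<chi> \<in> s\<close> and \<open>I\<^sup>R\<chi> \<notin> s\<close>. The axiom \<open>I\<phi> \<and> I(I\<phi> \<or> \<chi>) \<rightarrow> I\<^sup>R\<phi>\<close> puts every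
  such \<open>I\<chi>\<close> into \<open>\<lambda>(s)\<close>, so the canonical model is proper; the rule with \<open>n\<close> premises is exactly what
  the existence lemma for \<open>R\<^sup>\<bullet>\<close> needs.\<close>

section \<open>Soundness\<close>

lemma sat_Dis [simp]: "sat M s (Dis \<phi> \<psi>) \<longleftrightarrow> sat M s \<phi> \<or> sat M s \<psi>"
  by (simp add: Dis_def)

lemma sat_Imp [simp]: "sat M s (Imp \<phi> \<psi>) \<longleftrightarrow> (sat M s \<phi> \<longrightarrow> sat M s \<psi>)"
  by (simp add: Imp_def)

lemma sat_Iff [simp]: "sat M s (Iff \<phi> \<psi>) \<longleftrightarrow> (sat M s \<phi> \<longleftrightarrow> sat M s \<psi>)"
  by (auto simp: Iff_def)

lemma sat_conj_list [simp]: "sat M s (conj_list \<phi>s) \<longleftrightarrow> (\<forall>\<phi>\<in>set \<phi>s. sat M s \<phi>)"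
  by (induction \<phi>s rule: conj_list.induct) (auto simp: Top_def)

text \<open>Truth at a state is itself a Boolean evaluation of the atoms, which makes every
  tautology true at every state.\<close>

lemma prop_eval_sat: "prop_eval (sat M s) \<phi> \<longleftrightarrow> sat M s \<phi>"
  by (induction \<phi>) simp_all

text \<open>Several rules are justified by evaluating their premise at successors of
  \<open>s\<close>. Hence \<open>s\<close> stays arbitrary in the induction, and closure of the
  relations keeps these successors within \<open>states M\<close>.\<close>

lemma thm_IRIK_sound:
  assumes "thm_IRIK \<phi>" and closed: "rel M \<subseteq> states M \<times> states M" "brel M \<subseteq> states M \<times> states M"
    and proper: "rel M \<subseteq> brel M" and "s \<in> states M"
  shows "sat M s \<phi>"
  using assms(1,5)
proof (induction arbitrary: s)
  case (taut \<phi>)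
  then show ?case
    by (metis tautology_def prop_eval_sat)
next
  \<comment> \<open>A successor refuting \<open>Dis (Ign \<phi>) \<chi>\<close> refutes
    \<open>Ign \<phi>\<close>; properness makes it the \<open>brel\<close>-successor that
    \<open>RIgn \<phi>\<close> asks for.\<close>
  case (I_IR \<phi> \<chi>)
  then show ?case
    using proper by (auto simp: subset_iff)
next
  case (R_IR \<chi>s \<phi>)
  \<comment> \<open>If the antecedent of the conclusion holds at \<open>s\<close>, all
    \<open>brel\<close>-successors satisfy every \<open>Ign \<chi>\<close>, hence
    \<open>Ign \<phi>\<close> by the premise; so none can witness
    \<open>RIgn \<phi>\<close>.\<close>
  have "sat M t (Ign \<phi>)" if "(s, t) \<in> brel M" "\<forall>\<chi>\<in>set \<chi>s. sat M t (Ign \<chi>)" for t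
  proof -
    have "t \<in> states M"
      using that(1) closed by auto
    from R_IR.IH[OF this] that(2) show ?thesis
      by (simp only: sat_Imp sat_conj_list set_map ball_simps)
  qed
  then show ?case
    by (auto simp del: sat.simps(4,5) simp: sat_RIgn)
next
  case (RE_I \<phi> \<psi>)
  then have "sat M t \<phi> \<longleftrightarrow> sat M t \<psi>" if "(s, t) \<in> rel M" for t
    using that closed by auto
  then show ?case
    by auto
next
  case (RE_IR \<phi> \<psi>)
  then have "sat M t \<phi> \<longleftrightarrow> sat M t \<psi>" if "(u, t) \<in> rel M" for u t
    using that closed by auto
  then have "sat M u (Ign \<phi>) \<longleftrightarrow> sat M u (Ign \<psi>)" for u
    by auto
  then show ?case
    by (simp del: sat.simps(4,5) add: sat_RIgn)
next
  case (not_I \<phi>)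
  then show ?case
    using closed by auto
next
  case (IR_neg \<phi>)
  have "sat M t (Ign (Neg \<phi>)) \<longleftrightarrow> sat M t (Ign \<phi>)" for t
    by auto
  then show ?case
    by (simp del: sat.simps(4,5) add: sat_RIgn)
next
  case (I_neg \<phi>)
  then show ?case
    by auto
next
  case (I_con \<phi> \<psi>)
  then show ?case
    by auto
next
  \<comment> \<open>A successor refuting the first disjunction refutes \<phi>; one refuting the
    second satisfies \<phi>.\<close>
  case (I_dis \<phi> \<psi> \<chi>)
  then show ?case
    by auto
next
  case (IR_I \<phi>)
  then show ?case
    by simp
next
  case (MP \<phi> \<psi>)
  then show ?case
    by simp
qed

lemma deriv_IRIK_sound:
  fixes \<Gamma> :: "'p fm set"
  assumes "deriv_IRIK \<Gamma> \<phi>"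
  shows "conseq (proper_biframes :: 'w biframe set) \<Gamma> \<phi>"
  unfolding conseq_def
proof (intro allI impI ballI)
  fix M :: "('w, 'p) bimodel" and s
  assume M: "biframe.truncate M \<in> proper_biframes" and s: "s \<in> states M"
    and \<Gamma>: "\<forall>\<gamma>\<in>\<Gamma>. sat M s \<gamma>"
  obtain \<gamma>s where \<gamma>s: "set \<gamma>s \<subseteq> \<Gamma>" "thm_IRIK (Imp (conj_list \<gamma>s) \<phi>)"
    using assms unfolding deriv_IRIK_def by blast
  have "sat M s (Imp (conj_list \<gamma>s) \<phi>)"
    using M s
    by (intro thm_IRIK_sound[OF \<gamma>s(2)])
      (auto simp: proper_biframes_def is_biframe_def biframe.truncate_def)
  then show "sat M s \<phi>"
    using \<Gamma> \<gamma>s(1) by auto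
qed

section \<open>Maximal consistent sets\<close>

lemma prop_eval_Dis [simp]: "prop_eval v (Dis \<phi> \<psi>) \<longleftrightarrow> prop_eval v \<phi> \<or> prop_eval v \<psi>"
  by (simp add: Dis_def)

lemma prop_eval_Imp [simp]: "prop_eval v (Imp \<phi> \<psi>) \<longleftrightarrow> (prop_eval v \<phi> \<longrightarrow> prop_eval v \<psi>)"
  by (simp add: Imp_def)

lemma prop_eval_Iff [simp]: "prop_eval v (Iff \<phi> \<psi>) \<longleftrightarrow> (prop_eval v \<phi> \<longleftrightarrow> prop_eval v \<psi>)"
  by (auto simp: Iff_def)

lemma prop_eval_conj_list [simp]:
  "prop_eval v (conj_list \<phi>s) \<longleftrightarrow> (\<forall>\<phi>\<in>set \<phi>s. prop_eval v \<phi>)"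
  by (induction \<phi>s rule: conj_list.induct) (auto simp: Top_def)

text \<open>Lets evaluations replace derivations in the system: premises move one by one into
  implications until a tautology remains, and \<open>MP\<close> discharges them again.\<close>

lemma thm_IRIK_taut_conseq:
  assumes "\<forall>\<psi>\<in>set \<psi>s. thm_IRIK \<psi>"
    and "\<And>v. \<forall>\<psi>\<in>set \<psi>s. prop_eval v \<psi> \<Longrightarrow> prop_eval v \<phi>"
  shows "thm_IRIK \<phi>"
  using assms
proof (induction \<psi>s arbitrary: \<phi>)
  case Nil
  then show ?case
    by (simp add: taut tautology_def)
next
  case (Cons \<psi> \<psi>s)
  have "thm_IRIK (Imp \<psi> \<phi>)"
    using Cons.prems by (intro Cons.IH) auto
  then show ?case
    using Cons.prems(1) by (auto intro: MP)
qed

definition consistent :: "'p fm set \<Rightarrow> bool" where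
  "consistent X \<longleftrightarrow> (\<forall>\<gamma>s. set \<gamma>s \<subseteq> X \<longrightarrow> \<not> thm_IRIK (Neg (conj_list \<gamma>s)))"

definition mcs :: "'p fm set \<Rightarrow> bool" where
  "mcs X \<longleftrightarrow> consistent X \<and> (\<forall>Y. consistent Y \<longrightarrow> X \<subseteq> Y \<longrightarrow> Y = X)"

lemma inconsistent_insert:
  assumes "\<not> consistent (insert \<psi> X)"
  obtains \<gamma>s where "set \<gamma>s \<subseteq> X" "thm_IRIK (Imp (conj_list \<gamma>s) (Neg \<psi>))"
proof -
  obtain \<gamma>s where \<gamma>s: "set \<gamma>s \<subseteq> insert \<psi> X" "thm_IRIK (Neg (conj_list \<gamma>s))"
    using assms unfolding consistent_def by blast
  \<comment> \<open>Dropping every occurrence of \<psi> leaves only members of \<open>X\<close>; the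
    consequent \<open>Neg \<psi>\<close> accounts for what was dropped.\<close>
  have "thm_IRIK (Imp (conj_list (filter (\<lambda>\<gamma>. \<gamma> \<noteq> \<psi>) \<gamma>s)) (Neg \<psi>))"
    by (rule thm_IRIK_taut_conseq[of "[Neg (conj_list \<gamma>s)]"]) (use \<gamma>s(2) in auto)
  moreover have "set (filter (\<lambda>\<gamma>. \<gamma> \<noteq> \<psi>) \<gamma>s) \<subseteq> X"
    using \<gamma>s(1) by auto
  ultimately show thesis
    using that by blast
qed

lemma consistent_insert_Neg:
  assumes "\<not> deriv_IRIK X \<phi>"
  shows "consistent (insert (Neg \<phi>) X)"
proof (rule ccontr)
  assume "\<not> consistent (insert (Neg \<phi>) X)"
  then obtain \<gamma>s where \<gamma>s: "set \<gamma>s \<subseteq> X" "thm_IRIK (Imp (conj_list \<gamma>s) (Neg (Neg \<phi>)))"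
    by (rule inconsistent_insert)
  have "thm_IRIK (Imp (conj_list \<gamma>s) \<phi>)"
    by (rule thm_IRIK_taut_conseq[of "[Imp (conj_list \<gamma>s) (Neg (Neg \<phi>))]"]) (use \<gamma>s(2) in auto)
  with \<gamma>s(1) assms show False
    unfolding deriv_IRIK_def by blast
qed

lemma lindenbaum:
  assumes "consistent X"
  obtains Y where "X \<subseteq> Y" "mcs Y"
proof -
  have "\<exists>Y\<in>{Y. X \<subseteq> Y \<and> consistent Y}. \<forall>Z\<in>{Y. X \<subseteq> Y \<and> consistent Y}. Y \<subseteq> Z \<longrightarrow> Z = Y"
  proof (rule subset_Zorn_nonempty)
    fix C assume C: "C \<noteq> {}" "subset.chain {Y. X \<subseteq> Y \<and> consistent Y} C"
    then have sub: "C \<subseteq> {Y. X \<subseteq> Y \<and> consistent Y}"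
      by (simp add: subset_chain_def)
    have "consistent (\<Union>C)"
      unfolding consistent_def
    proof (intro allI impI)
      fix \<gamma>s assume "set \<gamma>s \<subseteq> \<Union>C"
      \<comment> \<open>A refutation uses finitely many formulas, so a single member of the chain
        contains them all.\<close>
      then obtain Y where "Y \<in> C" "set \<gamma>s \<subseteq> Y"
        using finite_subset_Union_chain[OF finite_set _ C] by blast
      moreover from sub \<open>Y \<in> C\<close> have "consistent Y"
        by auto
      ultimately show "\<not> thm_IRIK (Neg (conj_list \<gamma>s))"
        by (simp add: consistent_def)
    qed
    moreover have "X \<subseteq> \<Union>C"
      using sub C(1) by fastforce
    ultimately show "\<Union>C \<in> {Y. X \<subseteq> Y \<and> consistent Y}"
      by simp
  qed (use assms in blast)
  then obtain Y where Y: "X \<subseteq> Y" "consistent Y"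
      and max: "\<And>Z. X \<subseteq> Z \<Longrightarrow> consistent Z \<Longrightarrow> Y \<subseteq> Z \<Longrightarrow> Z = Y"
    by auto
  have "mcs Y"
    unfolding mcs_def using Y max order_trans by metis
  with Y(1) show thesis
    by (rule that)
qed

lemma mcs_taut_conseq:
  assumes X: "mcs X" and sub: "set \<gamma>s \<subseteq> X \<union> Collect thm_IRIK"
    and conseq: "\<And>v. \<forall>\<gamma>\<in>set \<gamma>s. prop_eval v \<gamma> \<Longrightarrow> prop_eval v \<phi>"
  shows "\<phi> \<in> X"
proof -
  have "consistent (insert \<phi> X)"
  proof (rule ccontr)
    assume "\<not> consistent (insert \<phi> X)"
    then obtain \<delta>s where \<delta>s: "set \<delta>s \<subseteq> X" "thm_IRIK (Imp (conj_list \<delta>s) (Neg \<phi>))"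
      by (rule inconsistent_insert)
    \<comment> \<open>The premises from \<open>X\<close> join the conjunction to be refuted, while
      the theorems serve as premises of the propositional inference.\<close>
    let ?\<gamma>X = "filter (\<lambda>\<gamma>. \<gamma> \<in> X) \<gamma>s" and ?\<gamma>T = "filter thm_IRIK \<gamma>s"
    have split: "set \<gamma>s = set ?\<gamma>X \<union> set ?\<gamma>T"
      using sub by auto
    have "thm_IRIK (Neg (conj_list (\<delta>s @ ?\<gamma>X)))"
    proof (rule thm_IRIK_taut_conseq)
      show "\<forall>\<psi>\<in>set (Imp (conj_list \<delta>s) (Neg \<phi>) # ?\<gamma>T). thm_IRIK \<psi>"
        using \<delta>s(2) by simp
      fix v assume v: "\<forall>\<psi>\<in>set (Imp (conj_list \<delta>s) (Neg \<phi>) # ?\<gamma>T). prop_eval v \<psi>"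
      have "prop_eval v \<phi>" if "\<forall>\<gamma>\<in>set ?\<gamma>X. prop_eval v \<gamma>"
        using that v by (intro conseq, subst split) auto
      then show "prop_eval v (Neg (conj_list (\<delta>s @ ?\<gamma>X)))"
        using v by auto
    qed
    moreover have "set (\<delta>s @ ?\<gamma>X) \<subseteq> X"
      using \<delta>s(1) by auto
    ultimately show False
      using X unfolding mcs_def consistent_def by blast
  qed
  then show ?thesis
    using X unfolding mcs_def by blast
qed

lemma mcs_Neg:
  assumes "mcs X"
  shows "Neg \<phi> \<in> X \<longleftrightarrow> \<phi> \<notin> X"
proof
  assume "\<phi> \<notin> X"
  then have "\<not> consistent (insert \<phi> X)"
    using assms unfolding mcs_def by blast
  then obtain \<gamma>s where "set \<gamma>s \<subseteq> X" "thm_IRIK (Imp (conj_list \<gamma>s) (Neg \<phi>))"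
    by (rule inconsistent_insert)
  then show "Neg \<phi> \<in> X"
    by (intro mcs_taut_conseq[OF assms, of "Imp (conj_list \<gamma>s) (Neg \<phi>) # \<gamma>s"]) auto
next
  assume "Neg \<phi> \<in> X"
  moreover have "thm_IRIK (Neg (conj_list [\<phi>, Neg \<phi>]))"
    by (simp add: taut tautology_def)
  then have "\<not> set [\<phi>, Neg \<phi>] \<subseteq> X"
    using assms unfolding mcs_def consistent_def by blast
  ultimately show "\<phi> \<notin> X"
    by simp
qed

lemma mcs_Con:
  assumes "mcs X"
  shows "Con \<phi> \<psi> \<in> X \<longleftrightarrow> \<phi> \<in> X \<and> \<psi> \<in> X"
proof
  assume "Con \<phi> \<psi> \<in> X"
  then show "\<phi> \<in> X \<and> \<psi> \<in> X"
    by (intro conjI mcs_taut_conseq[OF assms, of "[Con \<phi> \<psi>]"]) auto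
next
  assume "\<phi> \<in> X \<and> \<psi> \<in> X"
  then show "Con \<phi> \<psi> \<in> X"
    by (intro mcs_taut_conseq[OF assms, of "[\<phi>, \<psi>]"]) auto
qed

text \<open>Membership in \<open>X\<close> is an evaluation. Axioms and rule conclusions can thus be
  read as statements about membership, without derivations in the system.\<close>

lemma prop_eval_mcs:
  assumes "mcs X"
  shows "prop_eval (\<lambda>\<psi>. \<psi> \<in> X) \<phi> \<longleftrightarrow> \<phi> \<in> X"
  by (induction \<phi>) (simp_all add: mcs_Neg[OF assms] mcs_Con[OF assms])

lemma prop_eval_mcs_thm:
  assumes "mcs X" "thm_IRIK \<phi>"
  shows "prop_eval (\<lambda>\<psi>. \<psi> \<in> X) \<phi>"
  using assms mcs_taut_conseq[of X "[\<phi>]" \<phi>] by (simp add: prop_eval_mcs)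

lemma mcs_Ign_cong:
  assumes "mcs X" "thm_IRIK (Iff \<phi> \<psi>)"
  shows "Ign \<phi> \<in> X \<longleftrightarrow> Ign \<psi> \<in> X"
  using prop_eval_mcs_thm[OF assms(1) RE_I[OF assms(2)]] by simp

section \<open>The canonical model\<close>

definition known :: "'p fm set \<Rightarrow> 'p fm set" where
  "known s = {\<phi>. \<forall>\<chi>. Ign (Dis \<phi> \<chi>) \<notin> s}"

definition canonical :: "('p fm set, 'p) bimodel" where
  "canonical =
     \<lparr>states = {s. mcs s},
      rel = {(s, t). mcs s \<and> mcs t \<and> known s \<subseteq> t},
      brel = {(s, t). mcs s \<and> mcs t \<and> (\<forall>\<chi>. Ign \<chi> \<in> s \<longrightarrow> RIgn \<chi> \<notin> s \<longrightarrow> Ign \<chi> \<in> t)},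
      val = (\<lambda>p. {s. mcs s \<and> Var p \<in> s})\<rparr>"

text \<open>\<open>not_I\<close> settles the empty conjunction; otherwise disjunction distributes
  over conjunction, and \<open>I_con\<close> passes to the conjuncts.\<close>

lemma conj_list_known:
  assumes s: "mcs s" and "set \<gamma>s \<subseteq> known s"
  shows "conj_list \<gamma>s \<in> known s"
  using assms(2)
proof (induction \<gamma>s)
  case Nil
  have "thm_IRIK (Dis (conj_list []) \<chi>)" for \<chi> :: "'a fm"
    by (intro taut) (auto simp: tautology_def Top_def)
  from prop_eval_mcs_thm[OF s not_I[OF this]] show ?case
    by (simp add: known_def)
next
  case (Cons \<gamma> \<gamma>s)
  have "Ign (Dis (conj_list (\<gamma> # \<gamma>s)) \<chi>) \<notin> s" for \<chi>
  proof -
    \<comment> \<open>This also covers empty \<open>\<gamma>s\<close>, where the left side has just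
      \<gamma> and the right side an extra \<open>Top\<close>.\<close>
    have "thm_IRIK (Iff (Dis (conj_list (\<gamma> # \<gamma>s)) \<chi>) (Con (Dis \<gamma> \<chi>) (Dis (conj_list \<gamma>s) \<chi>)))"
      by (intro taut) (auto simp: tautology_def)
    moreover have "Ign (Con (Dis \<gamma> \<chi>) (Dis (conj_list \<gamma>s) \<chi>)) \<notin> s"
      using prop_eval_mcs_thm[OF s I_con] Cons by (fastforce simp: known_def)
    ultimately show ?thesis
      using mcs_Ign_cong[OF s] by blast
  qed
  then show ?case
    by (simp add: known_def)
qed

text \<open>If \<open>known s\<close> derived \<phi> from \<open>\<gamma>s\<close>, then \<phi>
  would be equivalent to its disjunction with \<open>conj_list \<gamma>s\<close>; taking \<phi>
  itself as the \<chi> in \<open>known\<close> gives a contradiction.\<close>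

lemma Ign_refuting_successor:
  assumes s: "mcs s" and I: "Ign \<phi> \<in> s"
  obtains t where "(s, t) \<in> rel canonical" "\<phi> \<notin> t"
proof -
  have "\<not> deriv_IRIK (known s) \<phi>"
  proof
    assume "deriv_IRIK (known s) \<phi>"
    then obtain \<gamma>s where \<gamma>s: "set \<gamma>s \<subseteq> known s" "thm_IRIK (Imp (conj_list \<gamma>s) \<phi>)"
      unfolding deriv_IRIK_def by blast
    have "thm_IRIK (Iff (Dis (conj_list \<gamma>s) \<phi>) \<phi>)"
      by (rule thm_IRIK_taut_conseq[of "[Imp (conj_list \<gamma>s) \<phi>]"]) (use \<gamma>s(2) in auto)
    then have "Ign (Dis (conj_list \<gamma>s) \<phi>) \<in> s"
      using mcs_Ign_cong[OF s] I by blast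
    then show False
      using conj_list_known[OF s \<gamma>s(1)] by (simp add: known_def)
  qed
  then obtain t where "insert (Neg \<phi>) (known s) \<subseteq> t" "mcs t"
    by (meson consistent_insert_Neg lindenbaum)
  then show thesis
    using that s by (auto simp: canonical_def mcs_Neg)
qed

lemma mcs_Ign_iff:
  assumes s: "mcs s"
  shows "Ign \<phi> \<in> s \<longleftrightarrow>
    (\<exists>t. (s, t) \<in> rel canonical \<and> \<phi> \<in> t) \<and> (\<exists>t. (s, t) \<in> rel canonical \<and> \<phi> \<notin> t)"
    (is "_ \<longleftrightarrow> ?R")
proof
  assume I: "Ign \<phi> \<in> s"
  have "Ign (Neg \<phi>) \<in> s"
    using prop_eval_mcs_thm[OF s I_neg[of \<phi>]] I by simp
  then obtain t where "(s, t) \<in> rel canonical" "Neg \<phi> \<notin> t"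
    by (rule Ign_refuting_successor[OF s])
  moreover from this have "\<phi> \<in> t"
    by (auto simp: canonical_def mcs_Neg)
  ultimately show ?R
    using Ign_refuting_successor[OF s I] by blast
next
  assume R: ?R
  show "Ign \<phi> \<in> s"
  proof (rule ccontr)
    assume "Ign \<phi> \<notin> s"
    \<comment> \<open>Otherwise some \<psi> and \<chi> would give both antecedents of
      \<open>I_dis\<close>. So all successors agree on \<phi>.\<close>
    then have "\<phi> \<in> known s \<or> Neg \<phi> \<in> known s"
      using prop_eval_mcs_thm[OF s I_dis[of \<phi>]] by (auto simp: known_def)
    then show False
      using R by (auto simp: canonical_def mcs_Neg)
  qed
qed

lemma mcs_RIgn_iff:
  assumes s: "mcs s"
  shows "RIgn \<phi> \<in> s \<longleftrightarrow> Ign \<phi> \<in> s \<and> (\<exists>t. (s, t) \<in> brel canonical \<and> Ign \<phi> \<notin> t)"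
    (is "_ \<longleftrightarrow> ?R")
proof
  assume RI: "RIgn \<phi> \<in> s"
  \<comment> \<open>These are the formulas that the definition of \<open>brel\<close> requires in
    each \<open>brel\<close>-successor of \<open>s\<close>.\<close>
  let ?X = "{Ign \<chi> | \<chi>. Ign \<chi> \<in> s \<and> RIgn \<chi> \<notin> s}"
  have "\<not> deriv_IRIK ?X (Ign \<phi>)"
  proof
    assume "deriv_IRIK ?X (Ign \<phi>)"
    then obtain \<gamma>s where \<gamma>s: "set \<gamma>s \<subseteq> ?X" "thm_IRIK (Imp (conj_list \<gamma>s) (Ign \<phi>))"
      unfolding deriv_IRIK_def by (elim exE conjE)
    have "\<forall>\<gamma>\<in>set \<gamma>s. \<exists>\<chi>. \<gamma> = Ign \<chi>"
      using \<gamma>s(1) by blast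
    then obtain \<chi>s where \<chi>s: "\<gamma>s = map Ign \<chi>s"
      by (metis ex_map_conv)
    \<comment> \<open>Every \<chi> in the list has \<open>Ign \<chi>\<close> in \<open>s\<close> and
      \<open>RIgn \<chi>\<close> outside it, so the antecedent of the conclusion of
      \<open>R_IR\<close> holds in \<open>s\<close>.\<close>
    have "RIgn \<phi> \<notin> s"
      using prop_eval_mcs_thm[OF s R_IR[OF \<gamma>s(2)[unfolded \<chi>s]]] \<gamma>s(1) unfolding \<chi>s by auto
    with RI show False
      by blast
  qed
  then obtain t where "insert (Neg (Ign \<phi>)) ?X \<subseteq> t" "mcs t"
    by (meson consistent_insert_Neg lindenbaum)
  then have "(s, t) \<in> brel canonical" "Ign \<phi> \<notin> t"
    using s by (auto simp: canonical_def mcs_Neg)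
  moreover have "Ign \<phi> \<in> s"
    using prop_eval_mcs_thm[OF s IR_I[of \<phi>]] RI by simp
  ultimately show ?R
    by blast
next
  assume ?R
  \<comment> \<open>Were \<open>RIgn \<phi>\<close> not in \<open>s\<close>, the definition of
    \<open>brel\<close> would put \<open>Ign \<phi>\<close> into every \<open>t\<close>.\<close>
  then show "RIgn \<phi> \<in> s"
    by (auto simp: canonical_def)
qed

lemma truth_lemma: "mcs s \<Longrightarrow> sat canonical s \<phi> \<longleftrightarrow> \<phi> \<in> s"
proof (induction \<phi> arbitrary: s)
  case (Var p)
  then show ?case
    by (simp add: canonical_def)
next
  case (Ign \<phi>)
  have "sat canonical t \<phi> \<longleftrightarrow> \<phi> \<in> t" if "(s, t) \<in> rel canonical" for t
    using that Ign.IH by (simp add: canonical_def)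
  with Ign.prems show ?case
    by (auto simp: mcs_Ign_iff)
next
  case (RIgn \<phi>)
  have "sat canonical u \<phi> \<longleftrightarrow> \<phi> \<in> u" if "(t, u) \<in> rel canonical" for t u
    using that RIgn.IH by (simp add: canonical_def)
  \<comment> \<open>\<open>Ign \<phi>\<close> is not a subformula of \<open>RIgn \<phi>\<close>, so
    its case is rebuilt from the induction hypothesis for \<phi>, at all \<open>t\<close> since
    \<open>brel\<close> leaves the \<open>rel\<close>-successors of \<open>s\<close>.\<close>
  then have *: "sat canonical t (Ign \<phi>) \<longleftrightarrow> Ign \<phi> \<in> t" if "mcs t" for t
    using that by (auto simp: mcs_Ign_iff)
  have "mcs t" if "(s, t) \<in> brel canonical" for t
    using that by (simp add: canonical_def)
  with * RIgn.prems show ?case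
    unfolding sat_RIgn mcs_RIgn_iff[OF RIgn.prems] by blast
qed (simp_all add: mcs_Neg mcs_Con)

lemma rel_canonical_subset_brel: "rel canonical \<subseteq> brel canonical"
proof -
  have "Ign \<phi> \<in> known s" if "mcs s" "Ign \<phi> \<in> s" "RIgn \<phi> \<notin> s" for s and \<phi> :: "'p fm"
    using prop_eval_mcs_thm[OF that(1) I_IR[of \<phi>]] that(2,3) by (auto simp: known_def)
  then show ?thesis
    by (fastforce simp: canonical_def)
qed

lemma conseq_imp_deriv_IRIK:
  fixes \<Gamma> :: "'p fm set"
  assumes "conseq (proper_biframes :: 'p fm set biframe set) \<Gamma> \<phi>"
  shows "deriv_IRIK \<Gamma> \<phi>"
proof (rule ccontr)
  assume "\<not> deriv_IRIK \<Gamma> \<phi>"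
  then obtain s where s: "insert (Neg \<phi>) \<Gamma> \<subseteq> s" "mcs s"
    by (meson consistent_insert_Neg lindenbaum)
  \<comment> \<open>The set \<open>s\<close> just obtained shows that the carrier is
    nonempty.\<close>
  have "is_biframe (biframe.truncate (canonical :: ('p fm set, 'p) bimodel))"
    using s(2) by (auto simp: is_biframe_def biframe.truncate_def canonical_def)
  moreover from this
  have "biframe.truncate (canonical :: ('p fm set, 'p) bimodel) \<in> proper_biframes"
    using rel_canonical_subset_brel by (auto simp: proper_biframes_def biframe.truncate_def)
  ultimately have "is_bimodel (canonical :: ('p fm set, 'p) bimodel)"
      and "biframe.truncate (canonical :: ('p fm set, 'p) bimodel) \<in> proper_biframes"
    by (auto simp: is_bimodel_def canonical_def)
  moreover have "s \<in> states canonical" "\<forall>\<gamma>\<in>\<Gamma>. sat canonical s \<gamma>"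
    using s by (auto simp: truth_lemma) (simp add: canonical_def)
  ultimately have "sat canonical s \<phi>"
    using assms unfolding conseq_def by blast
  then show False
    using s by (simp add: truth_lemma mcs_Neg)
qed

theorem theorem20:
  fixes \<Gamma> :: "'p fm set" and \<phi> :: "'p fm"
  shows "(deriv_IRIK \<Gamma> \<phi> \<longrightarrow> conseq (proper_biframes :: 'w biframe set) \<Gamma> \<phi>) \<and>
    (deriv_IRIK \<Gamma> \<phi> \<longleftrightarrow> conseq (proper_biframes :: 'p fm set biframe set) \<Gamma> \<phi>)"
  by (intro conjI impI iffI; erule deriv_IRIK_sound conseq_imp_deriv_IRIK)

end
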